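(* Let $A\in\mathbb C^{m\times m}$ be a complex symmetric matrix, and let $\mathcal D$ be the set of $w=(w_1,\dots,w_m)$ with all $w_k>0$ such that all singular values of $A_W=WAW$, $W=\operatorname{diag}(\sqrt{w_1},\dots,\sqrt{w_m})$, lie in $[0,1)$. For $w\in\mathcal D$ let $$P_{A,W}(\bar n)=\frac1{\mathcal Z}\,|\mathrm{Haf}(A_{\bar n})|^2\prod_{i=1}^m\frac{w_i^{n_i}}{n_i!},\qquad \frac1{\mathcal Z}=\sqrt{\det(\mathbb 1-X\mathcal A_W)},\quad \mathcal A_W=A_W\oplus A_W^* ,$$ a probability distribution on $\mathbb Z_{\ge0}^m$. Let $H:\mathbb Z_{\ge0}^m\to\mathbb R$ be such that $\sum_{\bar n}H(\bar n)P_{A,W}(\bar n)$ converges absolutely for every $w\in\mathcal D$. Let $w=w(\theta)$ be a differentiable function of $\theta=(\theta_1,\dots,\theta_d)$ in an open set, with values in $\mathcal D$, and let $C(\theta)=\sum_{\bar n}H(\bar n)P_{A,W(\theta)}(\bar n)$. Then $$\partial_\theta C(\theta)=\mathbb E_{\bar n\sim P_{A,W}}\left[\sum_{k=1}^m H(\bar n)\left(n_k-\langle n_k\rangle\right)\partial_\theta\log w_k\right],$$ where $\langle n_k\rangle=\frac{V_{k,k}+V_{k+m,k+m}-1}{2}$ with $V=(\mathbb 1-X\mathcal A_W)^{-1}-\mathbb 1/2$.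
   Context: $\partial_\theta$ denotes the gradient $(\partial/\partial\theta_1,\dots,\partial/\partial\theta_d)$. $X=\begin{pmatrix}0&\mathbb 1_m\\ \mathbb 1_m&0\end{pmatrix}$ and $A_W^*$ is the entrywise complex conjugate. For a symmetric matrix $B$ of even size $2r$, $\mathrm{Haf}(B)=\sum_\mu\prod_{\{i,j\}\in\mu}B_{ij}$, the sum running over all partitions $\mu$ of $\{1,\dots,2r\}$ into two-element subsets; $\mathrm{Haf}$ of the empty matrix is $1$ and $\mathrm{Haf}$ of an odd-size matrix is $0$. $A_{\bar n}$ is obtained from $A$ by repeating the $i$-th row and column $n_i$ times (deleting them if $n_i=0$). $P_{A,W}$ is the photon-number distribution of the pure $m$-mode Gaussian state with covariance matrix $V$, and $\langle n_k\rangle$ is the average number of photons in mode $k$ for that state. *)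

theory Defs
  imports "HOL-Analysis.Analysis"
begin

definition perfect_matchings :: "'i set \<Rightarrow> 'i set set set" where
  "perfect_matchings S = {\<mu>. partition_on S \<mu> \<and> (\<forall>e\<in>\<mu>. card e = 2)}"

text \<open>A matrix with rows and columns indexed by a finite set \<open>S\<close> is a function \<open>B\<close> restricted
  to \<open>S \<times> S\<close>; no order on \<open>S\<close> is needed. The definite description is meaningful for
  symmetric \<open>B\<close> only, which is the only case in which the hafnian is used.\<close>

definition hafnian :: "'i set \<Rightarrow> ('i \<Rightarrow> 'i \<Rightarrow> complex) \<Rightarrow> complex" where
  "hafnian S B =
     (\<Sum>\<mu>\<in>perfect_matchings S. \<Prod>e\<in>\<mu>. THE b. \<exists>i j. e = {i, j} \<and> b = B i j)"

text \<open>\<open>A\<close> with the \<open>i\<close>-th row and column repeated \<open>n $ i\<close> times: the copies of the index \<open>i\<close>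
  are the pairs \<open>(i, a)\<close> with \<open>a < n $ i\<close>.\<close>

definition rep_index :: "nat ^ 'm \<Rightarrow> ('m \<times> nat) set" where
  "rep_index n = {(i, a). a < n $ i}"

definition rep_matrix :: "complex ^ 'm ^ 'm \<Rightarrow> 'm \<times> nat \<Rightarrow> 'm \<times> nat \<Rightarrow> complex" where
  "rep_matrix A p q = A $ fst p $ fst q"

definition conj_mat :: "complex ^ 'n ^ 'm \<Rightarrow> complex ^ 'n ^ 'm" where
  "conj_mat M = (\<chi> i j. cnj (M $ i $ j))"

definition singular_values :: "complex ^ 'n ^ 'n \<Rightarrow> real set" where
  "singular_values M =
     {s. 0 \<le> s \<and> (\<exists>v. v \<noteq> 0 \<and>
            (transpose (conj_mat M) ** M) *v v = complex_of_real (s\<^sup>2) *s v)}"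

text \<open>The indices \<open>k\<close> and \<open>k + m\<close> of a matrix of size \<open>2m\<close> are \<open>Inl k\<close> and \<open>Inr k\<close>.\<close>

definition block_mat ::
  "'a ^ 'm ^ 'm \<Rightarrow> 'a ^ 'm ^ 'm \<Rightarrow> 'a ^ 'm ^ 'm \<Rightarrow> 'a ^ 'm ^ 'm \<Rightarrow> 'a ^ ('m + 'm) ^ ('m + 'm)" where
  "block_mat P Q R S = (\<chi> i j.
     case i of
       Inl k \<Rightarrow> (case j of Inl l \<Rightarrow> P $ k $ l | Inr l \<Rightarrow> Q $ k $ l)
     | Inr k \<Rightarrow> (case j of Inl l \<Rightarrow> R $ k $ l | Inr l \<Rightarrow> S $ k $ l))"

definition swap_mat :: "complex ^ ('m::finite + 'm) ^ ('m + 'm)" where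
  "swap_mat = block_mat 0 (mat 1) (mat 1) 0"

definition weight_mat :: "real ^ 'm \<Rightarrow> complex ^ 'm ^ 'm" where
  "weight_mat w = (\<chi> i j. if i = j then complex_of_real (sqrt (w $ i)) else 0)"

definition scaled :: "complex ^ 'm ^ 'm \<Rightarrow> real ^ 'm \<Rightarrow> complex ^ 'm ^ 'm" where
  "scaled A w = weight_mat w ** A ** weight_mat w"

definition doubled :: "complex ^ 'm ^ 'm \<Rightarrow> real ^ 'm \<Rightarrow> complex ^ ('m + 'm) ^ ('m + 'm)" where
  "doubled A w = block_mat (scaled A w) 0 0 (conj_mat (scaled A w))"

definition weight_domain :: "complex ^ 'm ^ 'm \<Rightarrow> (real ^ 'm) set" where
  "weight_domain A =
     {w. (\<forall>k. 0 < w $ k) \<and> (\<forall>s\<in>singular_values (scaled A w). 0 \<le> s \<and> s < 1)}"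

definition core :: "complex ^ 'm ^ 'm \<Rightarrow> real ^ 'm \<Rightarrow> complex ^ ('m + 'm) ^ ('m + 'm)" where
  "core A w = mat 1 - swap_mat ** doubled A w"

text \<open>The determinant is a real number (\<open>det_core_real\<close> below), so taking its real part only
  changes the type.\<close>

definition inv_Z :: "complex ^ 'm ^ 'm \<Rightarrow> real ^ 'm \<Rightarrow> real" where
  "inv_Z A w = sqrt (Re (det (core A w)))"

definition gbs_prob :: "complex ^ 'm ^ 'm \<Rightarrow> real ^ 'm \<Rightarrow> nat ^ 'm \<Rightarrow> real" where
  "gbs_prob A w n =
     inv_Z A w * (cmod (hafnian (rep_index n) (rep_matrix A)))\<^sup>2
       * (\<Prod>i\<in>UNIV. (w $ i) ^ (n $ i) / fact (n $ i))"

definition covariance :: "complex ^ 'm ^ 'm \<Rightarrow> real ^ 'm \<Rightarrow> complex ^ ('m + 'm) ^ ('m + 'm)" where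
  "covariance A w = matrix_inv (core A w) - mat (1 / 2)"

text \<open>The sum of the two diagonal entries is real (\<open>covariance_diag_cnj\<close> below).\<close>

definition mean_photons :: "complex ^ 'm ^ 'm \<Rightarrow> real ^ 'm \<Rightarrow> 'm \<Rightarrow> real" where
  "mean_photons A w k =
     (Re (covariance A w $ Inl k $ Inl k + covariance A w $ Inr k $ Inr k) - 1) / 2"

definition expect :: "('n \<Rightarrow> real) \<Rightarrow> ('n \<Rightarrow> 'v::real_normed_vector) \<Rightarrow> 'v" where
  "expect p f = (\<Sum>\<^sub>\<infinity>n. p n *\<^sub>R f n)"

definition gradient :: "(real ^ 'd \<Rightarrow> real) \<Rightarrow> real ^ 'd \<Rightarrow> real ^ 'd" where
  "gradient f x = (\<chi> j. deriv (\<lambda>t. f (x + t *\<^sub>R axis j 1)) 0)"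

lemma block_mat_mult:
  fixes P Q R S P' Q' R' S' :: "complex ^ 'm::finite ^ 'm"
  shows "block_mat P Q R S ** block_mat P' Q' R' S' =
    block_mat (P ** P' + Q ** R') (P ** Q' + Q ** S') (R ** P' + S ** R') (R ** Q' + S ** S')"
proof -
  have *: "(\<Sum>k\<in>UNIV. f k) = (\<Sum>k\<in>UNIV. f (Inl k)) + (\<Sum>k\<in>UNIV. f (Inr k))"
    for f :: "'m + 'm \<Rightarrow> complex"
    by (simp add: UNIV_Plus_UNIV[symmetric] sum.Plus del: UNIV_Plus_UNIV)
  show ?thesis
    by (simp add: vec_eq_iff matrix_matrix_mult_def block_mat_def * split: sum.split)
qed

lemma block_mat_one: "block_mat (mat 1) 0 0 (mat 1) = mat 1"
  by (simp add: vec_eq_iff block_mat_def mat_def split: sum.split)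

lemma block_mat_cases:
  fixes N :: "'a ^ ('m::finite + 'm) ^ ('m + 'm)"
  obtains P Q R S where "N = block_mat P Q R S"
proof
  show "N = block_mat (\<chi> k l. N $ Inl k $ Inl l) (\<chi> k l. N $ Inl k $ Inr l)
      (\<chi> k l. N $ Inr k $ Inl l) (\<chi> k l. N $ Inr k $ Inr l)"
    by (simp add: vec_eq_iff block_mat_def split: sum.split)
qed

lemma swap_mat_mult_swap: "(swap_mat ** swap_mat :: complex ^ ('m::finite + 'm) ^ ('m + 'm)) = mat 1"
  by (simp add: swap_mat_def block_mat_mult block_mat_one)

lemma swap_mat_conjugate: "swap_mat ** block_mat P Q R S ** swap_mat = block_mat S R Q P"
  by (simp add: swap_mat_def block_mat_mult)

lemma core_block:
  "core A w = block_mat (mat 1) (- conj_mat (scaled A w)) (- scaled A w) (mat 1)"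
proof -
  have "core A w = block_mat (mat 1) 0 0 (mat 1)
      - block_mat 0 (conj_mat (scaled A w)) (scaled A w) 0"
    by (simp add: core_def doubled_def swap_mat_def block_mat_mult block_mat_one)
  then show ?thesis
    by (simp add: vec_eq_iff block_mat_def split: sum.split)
qed

lemma conj_mat_mult:
  fixes M :: "complex ^ 'n::finite ^ 'n" shows "conj_mat (M ** N) = conj_mat M ** conj_mat N"
  by (simp add: vec_eq_iff conj_mat_def matrix_matrix_mult_def)

lemma det_conj_mat:
  fixes M :: "complex ^ 'n::finite ^ 'n" shows "det (conj_mat M) = cnj (det M)"
  by (simp add: conj_mat_def det_def)

lemma conj_core: "conj_mat (core A w) = swap_mat ** core A w ** swap_mat"
  by (simp add: core_block swap_mat_conjugate)
    (simp add: vec_eq_iff conj_mat_def block_mat_def mat_def split: sum.split)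

lemma det_core_real: "Im (det (core A w)) = 0"
proof -
  have 1: "det (swap_mat :: complex ^ ('a + 'a) ^ ('a + 'a)) * det (swap_mat :: complex ^ ('a + 'a) ^ ('a + 'a)) = 1"
    by (metis det_mul det_I swap_mat_mult_swap)
  have "cnj (det (core A w)) = det (core A w)"
    using 1 by (simp flip: det_conj_mat add: conj_core det_mul)
  then show ?thesis by (metis Reals_cnj_iff complex_is_Real_iff)
qed

lemma covariance_diag_cnj:
  assumes "invertible (core A w)"
  shows "cnj (covariance A w $ Inl k $ Inl k) = covariance A w $ Inr k $ Inr k"
proof -
  define M where "M = core A w"
  define N where "N = matrix_inv M"
  define X :: "complex ^ ('a + 'a) ^ ('a + 'a)" where "X = swap_mat"
  have XX: "X ** X = mat 1" by (simp add: X_def swap_mat_mult_swap)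
  have MN: "M ** N = mat 1" "N ** M = mat 1"
    using assms someI_ex[of "\<lambda>N. M ** N = mat 1 \<and> N ** M = mat 1"]
    by (auto simp: M_def N_def invertible_def matrix_inv_def)
  have one: "conj_mat (mat 1) = (mat 1 :: complex ^ ('a + 'a) ^ ('a + 'a))"
    by (simp add: vec_eq_iff conj_mat_def mat_def)
  have "X ** M ** X ** conj_mat N = mat 1"
    by (metis MN(1) M_def X_def conj_core conj_mat_mult one)
  then have "X ** N ** X ** (X ** M ** X ** conj_mat N) = X ** N ** X"
    by simp
  moreover have "X ** N ** X ** (X ** M ** X ** conj_mat N) = conj_mat N"
    by (metis MN(2) XX matrix_mul_assoc matrix_mul_lid matrix_mul_rid)
  ultimately have "conj_mat N = X ** N ** X" by simp
  moreover obtain P Q R S where "N = block_mat P Q R S"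
    by (rule block_mat_cases)
  ultimately have "conj_mat N $ Inl k $ Inl k = N $ Inr k $ Inr k"
    by (simp add: X_def swap_mat_conjugate) (simp add: block_mat_def)
  then show ?thesis
    by (simp add: covariance_def N_def M_def conj_mat_def mat_def)
qed

end

theory Submission
  imports Defs
begin

text \<open>The hafnian enters only through the coefficients of a power series: \<open>C\<close> is the product of
  \<open>inv_Z A w\<close> and \<open>\<Sum>n. a n * w\<^sup>n\<close> with \<open>a n\<close> independent of \<open>w\<close>. The singular values of
  \<open>scaled A w\<close> stay away from \<open>1\<close>, so \<open>c *\<^sub>R w\<close> still lies in the domain for some \<open>c > 1\<close>;
  hence the series converges absolutely beyond \<open>w\<close> and can be differentiated termwise, which
  yields the factors \<open>n $ k / w $ k\<close>. By Jacobi's formula the logarithmic derivative of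
  \<open>inv_Z A w\<close> with respect to \<open>w $ k\<close> is \<open>- mean_photons A w k / w $ k\<close>.\<close>

section \<open>Termwise differentiation\<close>

text \<open>An e/2 argument: since \<open>B\<close> is summable, the remainders outside a finite set
  add up to at most a small multiple of \<open>norm (y - x)\<close>, uniformly in \<open>y\<close>,
  and the remaining finite sum is differentiable in the ordinary way.\<close>

lemma has_derivative_infsum:
  fixes f :: "'i \<Rightarrow> 'a::real_normed_vector \<Rightarrow> 'b::banach"
  assumes S: "convex S" "x \<in> S"
    and der: "\<And>i y. i \<in> I \<Longrightarrow> y \<in> S \<Longrightarrow> (f i has_derivative f' i y) (at y within S)"
    and bound: "\<And>i y h. i \<in> I \<Longrightarrow> y \<in> S \<Longrightarrow> norm (f' i y h) \<le> B i * norm h"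
    and nonneg: "\<And>i. i \<in> I \<Longrightarrow> 0 \<le> B i"
    and B: "B summable_on I"
    and summable: "\<And>y. y \<in> S \<Longrightarrow> (\<lambda>i. f i y) summable_on I"
  shows "((\<lambda>y. \<Sum>\<^sub>\<infinity>i\<in>I. f i y) has_derivative (\<lambda>h. \<Sum>\<^sub>\<infinity>i\<in>I. f' i x h)) (at x within S)"
  unfolding has_derivative_within_alt
proof (intro conjI allI impI)
  have lin: "bounded_linear (f' i x)" if "i \<in> I" for i
    using der[OF that S(2)] by (rule has_derivative_bounded_linear)
  have summable_B: "(\<lambda>i. B i * c) summable_on I" for c
    by (intro summable_on_cmult_left B)
  have abs_summable': "(\<lambda>i. norm (f' i x h)) summable_on I" for h
    by (rule summable_on_comparison_test[OF summable_B[of "norm h"]]) (auto intro: bound S)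
  then have summable': "(\<lambda>i. f' i x h) summable_on I" for h
    by (rule abs_summable_summable)
  show "bounded_linear (\<lambda>h. \<Sum>\<^sub>\<infinity>i\<in>I. f' i x h)"
  proof (rule bounded_linear_intro)
    fix g h :: 'a and r :: real
    have "(\<Sum>\<^sub>\<infinity>i\<in>I. f' i x (g + h)) = (\<Sum>\<^sub>\<infinity>i\<in>I. f' i x g + f' i x h)"
      by (intro infsum_cong linear_add bounded_linear.linear lin)
    also have "\<dots> = (\<Sum>\<^sub>\<infinity>i\<in>I. f' i x g) + (\<Sum>\<^sub>\<infinity>i\<in>I. f' i x h)"
      by (intro infsum_add summable')
    finally show "(\<Sum>\<^sub>\<infinity>i\<in>I. f' i x (g + h)) = (\<Sum>\<^sub>\<infinity>i\<in>I. f' i x g) + (\<Sum>\<^sub>\<infinity>i\<in>I. f' i x h)" .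
    have "(\<Sum>\<^sub>\<infinity>i\<in>I. f' i x (r *\<^sub>R h)) = (\<Sum>\<^sub>\<infinity>i\<in>I. r *\<^sub>R f' i x h)"
      by (intro infsum_cong linear_scale bounded_linear.linear lin)
    then show "(\<Sum>\<^sub>\<infinity>i\<in>I. f' i x (r *\<^sub>R h)) = r *\<^sub>R (\<Sum>\<^sub>\<infinity>i\<in>I. f' i x h)"
      by (simp add: infsum_scaleR_right)
    have "norm (\<Sum>\<^sub>\<infinity>i\<in>I. f' i x h) \<le> (\<Sum>\<^sub>\<infinity>i\<in>I. B i * norm h)"
      by (rule norm_infsum_le[OF has_sum_infsum has_sum_infsum])
        (auto intro: summable' summable_B bound S)
    then show "norm (\<Sum>\<^sub>\<infinity>i\<in>I. f' i x h) \<le> norm h * (\<Sum>\<^sub>\<infinity>i\<in>I. B i)"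
      by (simp add: infsum_cmult_left' mult.commute)
  qed
  fix e :: real assume e: "e > 0"
  define R where "R i y = f i y - f i x - f' i x (y - x)" for i y
  \<comment> \<open>The mean value inequality on the convex set \<open>S\<close> bounds the
    increment by \<open>B i * norm (y - x)\<close>, and the linear part obeys the same bound, hence
    the factor 2.\<close>
  have R: "norm (R i y) \<le> B i * (2 * norm (y - x))" if "i \<in> I" "y \<in> S" for i y
  proof -
    have "norm (f i y - f i x) \<le> B i * norm (y - x)"
    proof (rule differentiable_bound[OF S(1) _ _ that(2) S(2)])
      fix z assume "z \<in> S"
      then show "(f i has_derivative f' i z) (at z within S)"
        by (rule der[OF that(1)])
      show "onorm (f' i z) \<le> B i"
        by (rule onorm_bound[OF nonneg[OF that(1)] bound[OF that(1) \<open>z \<in> S\<close>]])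
    qed
    moreover have "norm (f' i x (y - x)) \<le> B i * norm (y - x)"
      using that S by (intro bound)
    ultimately show ?thesis
      unfolding R_def using norm_triangle_ineq4[of "f i y - f i x" "f' i x (y - x)"]
      by (simp add: algebra_simps)
  qed
  have summable_R: "(\<lambda>i. R i y) summable_on J" if "y \<in> S" "J \<subseteq> I" for y J
    by (rule abs_summable_summable, rule summable_on_comparison_test
        [OF summable_on_subset_banach[OF summable_B[of "2 * norm (y - x)"] that(2)]])
      (use that R in auto)
  \<comment> \<open>The tail of \<open>B\<close> enters with the factor 2 of \<open>R\<close>, so
    \<open>e / 4\<close> here leaves \<open>e / 2\<close> for the head.\<close>
  obtain F where F: "finite F" "F \<subseteq> I" "dist (sum B F) (infsum B I) \<le> e / 4"
    using infsum_finite_approximation[OF B, of "e / 4"] e by auto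
  have I: "I = F \<union> (I - F)" using F by auto
  have BF: "B summable_on (I - F)"
    using B by (rule summable_on_subset_banach) auto
  have "infsum B I = sum B F + infsum B (I - F)"
    by (subst I, subst infsum_Un_disjoint) (use F BF in auto)
  then have tail: "infsum B (I - F) \<le> e / 4"
    using F(3) by (simp add: dist_real_def)
  have "((\<lambda>y. \<Sum>i\<in>F. f i y) has_derivative (\<lambda>h. \<Sum>i\<in>F. f' i x h)) (at x within S)"
    using F S by (intro has_derivative_sum der) auto
  then obtain d where d: "d > 0"
    and head: "\<And>y. y \<in> S \<Longrightarrow> norm (y - x) < d \<Longrightarrow>
      norm ((\<Sum>i\<in>F. f i y) - (\<Sum>i\<in>F. f i x) - (\<Sum>i\<in>F. f' i x (y - x))) \<le> e / 2 * norm (y - x)"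
    using e unfolding has_derivative_within_alt by (meson half_gt_zero)
  show "\<exists>d>0. \<forall>y\<in>S. norm (y - x) < d \<longrightarrow>
      norm ((\<Sum>\<^sub>\<infinity>i\<in>I. f i y) - (\<Sum>\<^sub>\<infinity>i\<in>I. f i x) - (\<Sum>\<^sub>\<infinity>i\<in>I. f' i x (y - x))) \<le> e * norm (y - x)"
  proof (intro exI[of _ d] conjI ballI impI d)
    fix y assume y: "y \<in> S" "norm (y - x) < d"
    have "((\<lambda>i. f i y + - f i x + - f' i x (y - x)) has_sum
        (\<Sum>\<^sub>\<infinity>i\<in>I. f i y) + - (\<Sum>\<^sub>\<infinity>i\<in>I. f i x) + - (\<Sum>\<^sub>\<infinity>i\<in>I. f' i x (y - x))) I"
      using y S
      by (intro has_sum_add has_sum_infsum summable summable')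
        (simp_all add: has_sum_uminus has_sum_infsum summable summable')
    then have "(\<Sum>\<^sub>\<infinity>i\<in>I. f i y) - (\<Sum>\<^sub>\<infinity>i\<in>I. f i x) - (\<Sum>\<^sub>\<infinity>i\<in>I. f' i x (y - x))
        = (\<Sum>\<^sub>\<infinity>i\<in>I. R i y)"
      by (simp add: infsumI R_def)
    also have "\<dots> = (\<Sum>i\<in>F. R i y) + (\<Sum>\<^sub>\<infinity>i\<in>I - F. R i y)"
      by (subst I, subst infsum_Un_disjoint) (use F y in \<open>auto intro!: summable_R\<close>)
    finally have *: "(\<Sum>\<^sub>\<infinity>i\<in>I. f i y) - (\<Sum>\<^sub>\<infinity>i\<in>I. f i x) - (\<Sum>\<^sub>\<infinity>i\<in>I. f' i x (y - x))
        = (\<Sum>i\<in>F. R i y) + (\<Sum>\<^sub>\<infinity>i\<in>I - F. R i y)" .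
    have "norm (\<Sum>\<^sub>\<infinity>i\<in>I - F. R i y) \<le> (\<Sum>\<^sub>\<infinity>i\<in>I - F. B i * (2 * norm (y - x)))"
      by (rule norm_infsum_le[OF has_sum_infsum has_sum_infsum])
        (use y in \<open>auto intro!: summable_R R summable_on_cmult_left BF\<close>)
    also have "\<dots> = infsum B (I - F) * (2 * norm (y - x))"
      by (rule infsum_cmult_left')
    also have "\<dots> \<le> e / 4 * (2 * norm (y - x))"
      by (intro mult_right_mono tail) auto
    finally have "norm (\<Sum>\<^sub>\<infinity>i\<in>I - F. R i y) \<le> e / 2 * norm (y - x)" by simp
    moreover have "norm (\<Sum>i\<in>F. R i y) \<le> e / 2 * norm (y - x)"
      using head[OF y] by (simp add: R_def sum_subtractf)
    ultimately show "norm ((\<Sum>\<^sub>\<infinity>i\<in>I. f i y) - (\<Sum>\<^sub>\<infinity>i\<in>I. f i x) - (\<Sum>\<^sub>\<infinity>i\<in>I. f' i x (y - x)))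
        \<le> e * norm (y - x)"
      unfolding * using norm_triangle_ineq[of "\<Sum>i\<in>F. R i y" "\<Sum>\<^sub>\<infinity>i\<in>I - F. R i y"]
      by (simp add: algebra_simps)
  qed
qed

section \<open>Finite sums of convergent families\<close>

lemma has_sum_sum:
  fixes f :: "'k \<Rightarrow> 'i \<Rightarrow> 'b::topological_comm_monoid_add"
  assumes "\<And>k. k \<in> K \<Longrightarrow> (f k has_sum s k) I"
  shows "((\<lambda>i. \<Sum>k\<in>K. f k i) has_sum (\<Sum>k\<in>K. s k)) I"
  using assms by (induction K rule: infinite_finite_induct) (auto intro: has_sum_add)

lemma summable_on_sum:
  fixes f :: "'k \<Rightarrow> 'i \<Rightarrow> 'b::{topological_comm_monoid_add, t2_space}"
  assumes "\<And>k. k \<in> K \<Longrightarrow> f k summable_on I"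
  shows "(\<lambda>i. \<Sum>k\<in>K. f k i) summable_on I"
  using has_sum_sum[OF has_sum_infsum[OF assms]] by (rule has_sum_imp_summable)

text \<open>The sequence \<open>n * (p / q) ^ n\<close> tends to 0 and is therefore bounded. This
  absorbs the factor \<open>n\<close> produced by differentiation at the price of a slightly larger
  radius.\<close>

lemma mult_power_bounded:
  fixes p q :: real
  assumes "0 \<le> p" "p < q"
  obtains K where "\<And>n. real n * p ^ n \<le> K * q ^ n" "0 \<le> K"
proof -
  have "norm (p / q) < 1" using assms by simp
  then have "(\<lambda>n. of_nat n * (p / q) ^ n) \<longlonglongrightarrow> 0"
    by (rule powser_times_n_limit_0)
  then have "Bseq (\<lambda>n. of_nat n * (p / q) ^ n)"
    by (intro convergent_imp_Bseq convergentI)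
  then obtain K where K: "0 < K" "\<And>n. norm (of_nat n * (p / q) ^ n) \<le> K"
    by (auto simp: Bseq_def)
  have "real n * p ^ n \<le> K * q ^ n" for n
    using K(2)[of n] assms by (simp add: power_divide field_simps abs_mult)
  with K(1) show thesis by (intro that[of K]) auto
qed

text \<open>In logarithmic form the derivative is the monomial itself times a linear expression in
  the exponents, so termwise differentiation only inserts factors \<open>n $ k\<close> into the
  series. Positivity of \<open>u\<close> makes the division legitimate.\<close>

lemma has_derivative_monomial:
  fixes u :: "real ^ 'm" and n :: "nat ^ 'm"
  assumes "\<And>k. 0 < u $ k"
  shows "((\<lambda>u. \<Prod>i\<in>UNIV. (u $ i) ^ (n $ i)) has_derivative
     (\<lambda>h. (\<Prod>i\<in>UNIV. (u $ i) ^ (n $ i)) * (\<Sum>k\<in>UNIV. real (n $ k) * (h $ k / u $ k))))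
         (at u within S)"
proof -
  have nth: "((\<lambda>u::real^'m. u $ i) has_derivative (\<lambda>h. h $ i)) (at u within S)" for i
    by (rule bounded_linear_imp_has_derivative[OF bounded_linear_vec_nth])
  have "((\<lambda>u. \<Prod>i\<in>UNIV. (u $ i) ^ (n $ i)) has_derivative
     (\<lambda>h. \<Sum>k\<in>UNIV. real (n $ k) * h $ k * (u $ k) ^ (n $ k - 1)
         * (\<Prod>i\<in>UNIV - {k}. (u $ i) ^ (n $ i))))
     (at u within S)"
    by (intro has_derivative_prod has_derivative_eq_rhs[OF has_derivative_power[OF nth]]) (auto
        simp: mult_ac)
  also have "(\<lambda>h. \<Sum>k\<in>UNIV. real (n $ k) * h $ k * (u $ k) ^ (n $ k - 1)
      * (\<Prod>i\<in>UNIV - {k}. (u $ i) ^ (n $ i)))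
     = (\<lambda>h. (\<Prod>i\<in>UNIV. (u $ i) ^ (n $ i)) * (\<Sum>k\<in>UNIV. real (n $ k) * (h $ k / u $ k)))"
  proof
    fix h :: "real ^ 'm"
    have "real (n $ k) * h $ k * (u $ k) ^ (n $ k - 1) * (\<Prod>i\<in>UNIV - {k}. (u $ i) ^ (n $ i))
       = (\<Prod>i\<in>UNIV. (u $ i) ^ (n $ i)) * (real (n $ k) * (h $ k / u $ k))" for k
    proof -
      have "(\<Prod>i\<in>UNIV. (u $ i) ^ (n $ i)) = (u $ k) ^ (n $ k) * (\<Prod>i\<in>UNIV - {k}. (u $ i) ^ (n $ i))"
        by (rule prod.remove) auto
      \<comment> \<open>For \<open>n $ k = 0\<close> the truncated exponent \<open>n $ k - 1\<close>
        is harmless, since both sides carry the factor 0.\<close>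
      moreover have "real (n $ k) * h $ k * (u $ k) ^ (n $ k - 1) = (u $ k) ^ (n $ k)
          * (real (n $ k) * (h $ k / u $ k))"
        using assms[of k] by (cases "n $ k") (simp_all add: mult_ac)
      ultimately show ?thesis by simp
    qed
    then show "(\<Sum>k\<in>UNIV. real (n $ k) * h $ k * (u $ k) ^ (n $ k - 1)
        * (\<Prod>i\<in>UNIV - {k}. (u $ i) ^ (n $ i)))
       = (\<Prod>i\<in>UNIV. (u $ i) ^ (n $ i)) * (\<Sum>k\<in>UNIV. real (n $ k) * (h $ k / u $ k))"
      by (simp add: sum_distrib_left)
  qed
  finally show ?thesis .
qed

text \<open>In coordinate \<open>k\<close> the gap between \<open>b\<close> and \<open>c\<close>
  trades \<open>n $ k * b ^ (n $ k)\<close> for \<open>K * c ^ (n $ k)\<close>. In all other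
  coordinates replacing \<open>b\<close> by \<open>c\<close> is plain monotonicity.\<close>

lemma summable_on_powser_times_exponent:
  fixes v :: "real ^ 'm" and a :: "nat ^ 'm \<Rightarrow> real"
  assumes v: "\<And>k. 0 \<le> v $ k" and c: "0 \<le> b" "b < c"
    and a: "(\<lambda>n. \<bar>a n\<bar> * (\<Prod>i\<in>UNIV. (c * v $ i) ^ (n $ i))) summable_on UNIV"
  shows "(\<lambda>n. \<bar>a n\<bar> * (\<Prod>i\<in>UNIV. (b * v $ i) ^ (n $ i)) * real (n $ k)) summable_on UNIV"
proof -
  obtain K where K: "\<And>n. real n * b ^ n \<le> K * c ^ n" "0 \<le> K"
    using mult_power_bounded[OF c] by blast
  show ?thesis
  proof (rule summable_on_comparison_test[OF summable_on_cmult_right[OF a, of K]])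
    fix n :: "nat ^ 'm"
    let ?P = "\<lambda>c. \<Prod>i\<in>UNIV - {k}. (c * v $ i) ^ (n $ i)"
    have split: "(\<Prod>i\<in>UNIV. (c * v $ i) ^ (n $ i)) = c ^ (n $ k) * ((v $ k) ^ (n $ k) * ?P c)" for c
      by (subst prod.remove[of UNIV k]) (auto simp: power_mult_distrib)
    have P: "0 \<le> ?P b" "?P b \<le> ?P c"
      using v c by (auto intro!: prod_nonneg prod_mono power_mono mult_right_mono)
    have "real (n $ k) * b ^ (n $ k) * ((v $ k) ^ (n $ k) * ?P b) \<le> K * c ^ (n $ k)
        * ((v $ k) ^ (n $ k) * ?P c)"
      by (rule mult_mono[OF K(1) mult_left_mono[OF P(2)]]) (use v c K P in auto)
    then have "\<bar>a n\<bar> * (real (n $ k) * b ^ (n $ k) * ((v $ k) ^ (n $ k) * ?P b))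
        \<le> \<bar>a n\<bar> * (K * c ^ (n $ k) * ((v $ k) ^ (n $ k) * ?P c))"
      by (rule mult_left_mono) simp
    then show "\<bar>a n\<bar> * (\<Prod>i\<in>UNIV. (b * v $ i) ^ (n $ i)) * real (n $ k)
        \<le> K * (\<bar>a n\<bar> * (\<Prod>i\<in>UNIV. (c * v $ i) ^ (n $ i)))"
      unfolding split by (simp only: mult_ac)
  qed (use v c in \<open>auto intro!: mult_nonneg_nonneg prod_nonneg\<close>)
qed

text \<open>Absolute convergence at \<open>c\<close> times \<open>v\<close> supplies one summable
  majorant for the derivatives of the terms on a whole neighbourhood of \<open>v\<close>.\<close>

lemma has_derivative_powser:
  fixes v :: "real ^ 'm" and a :: "nat ^ 'm \<Rightarrow> real"
  assumes v: "\<And>k. 0 < v $ k" and c: "1 < c"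
    and a: "(\<lambda>n. \<bar>a n\<bar> * (\<Prod>i\<in>UNIV. (c * v $ i) ^ (n $ i))) summable_on UNIV"
  shows "((\<lambda>u. \<Sum>\<^sub>\<infinity>n. a n * (\<Prod>i\<in>UNIV. (u $ i) ^ (n $ i))) has_derivative
    (\<lambda>h. \<Sum>\<^sub>\<infinity>n. a n * ((\<Prod>i\<in>UNIV. (v $ i) ^ (n $ i)) * (\<Sum>k\<in>UNIV. real (n $ k) * (h $ k / v $ k)))))
        (at v)"
proof -
  \<comment> \<open>\<open>1 < b\<close> puts \<open>v\<close> inside the box, and
    \<open>b < c\<close> leaves the gap that absorbs the exponent. The lower corner
    \<open>v / 2\<close> keeps coordinates away from 0, so that \<open>1 / u $ k\<close> is at most
    \<open>2 / v $ k\<close>.\<close>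
  obtain b where b: "1 < b" "b < c" using dense[OF c] by blast
  define S where "S = box ((1/2) *\<^sub>R v) (b *\<^sub>R v)"
  have mem: "v $ k / 2 < u $ k" "u $ k < b * v $ k" "0 < u $ k" if "u \<in> S" for u k
  proof -
    show 1: "v $ k / 2 < u $ k" "u $ k < b * v $ k" using that by (auto simp: S_def mem_box_cart)
    show "0 < u $ k" using 1(1) v[of k] by linarith
  qed
  have vS: "v \<in> S" using v b by (simp add: S_def mem_box_cart)
  have le: "(\<Prod>i\<in>UNIV. (u $ i) ^ (n $ i)) \<le> (\<Prod>i\<in>UNIV. (b * v $ i) ^ (n $ i))"
    and nonneg: "0 \<le> (\<Prod>i\<in>UNIV. (u $ i) ^ (n $ i))" if "u \<in> S" for u and n :: "nat ^ 'm"
  proof -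
    have "0 \<le> u $ i" "u $ i \<le> b * v $ i" for i
      using mem[OF that, of i] by simp_all
    then show "(\<Prod>i\<in>UNIV. (u $ i) ^ (n $ i)) \<le> (\<Prod>i\<in>UNIV. (b * v $ i) ^ (n $ i))"
      "0 \<le> (\<Prod>i\<in>UNIV. (u $ i) ^ (n $ i))"
      by (auto intro!: prod_mono power_mono prod_nonneg)
  qed
  \<comment> \<open>The majorant takes the monomial at the upper corner of the box and
    \<open>1 / u $ k\<close> at the lower one; \<open>norm h\<close> dominates each component of
    \<open>h\<close>.\<close>
  define B where "B n = (\<Sum>k\<in>UNIV. \<bar>a n\<bar> * (\<Prod>i\<in>UNIV. (b * v $ i) ^ (n $ i)) * real (n $ k)
      * (2 / v $ k))"
    for n :: "nat ^ 'm"
  have "((\<lambda>u. \<Sum>\<^sub>\<infinity>n. a n * (\<Prod>i\<in>UNIV. (u $ i) ^ (n $ i))) has_derivative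
    (\<lambda>h. \<Sum>\<^sub>\<infinity>n. a n * ((\<Prod>i\<in>UNIV. (v $ i) ^ (n $ i)) * (\<Sum>k\<in>UNIV. real (n $ k) * (h $ k / v $ k)))))
    (at v within S)"
  proof (rule has_derivative_infsum[where B = B and f' = "\<lambda>n u h. a n
      * ((\<Prod>i\<in>UNIV. (u $ i) ^ (n $ i)) * (\<Sum>k\<in>UNIV. real (n $ k) * (h $ k / u $ k)))"])
    show "convex S" by (simp add: S_def)
    show "v \<in> S" by fact
    show "((\<lambda>u. a n * (\<Prod>i\<in>UNIV. (u $ i) ^ (n $ i))) has_derivative
      (\<lambda>h. a n * ((\<Prod>i\<in>UNIV. (u $ i) ^ (n $ i)) * (\<Sum>k\<in>UNIV. real (n $ k) * (h $ k / u $ k)))))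
          (at u within S)"
      if "u \<in> S" for n :: "nat ^ 'm" and u
      using mem[OF that] by (intro has_derivative_mult_right has_derivative_monomial)
    show "norm (a n * ((\<Prod>i\<in>UNIV. (u $ i) ^ (n $ i)) * (\<Sum>k\<in>UNIV. real (n $ k) * (h $ k / u $ k))))
        \<le> B n * norm h"
      if u: "u \<in> S" for n :: "nat ^ 'm" and u h
    proof -
      have "\<bar>h $ k / u $ k\<bar> \<le> norm h * (2 / v $ k)" for k
      proof -
        have "\<bar>h $ k\<bar> / u $ k \<le> norm h / (v $ k / 2)"
          using mem[OF u, of k] v[of k] component_le_norm_cart[of h k] by (intro frac_le) auto
        then show ?thesis using mem[OF u, of k] by simp
      qed
      then have "\<bar>\<Sum>k\<in>UNIV. real (n $ k) * (h $ k / u $ k)\<bar> \<le> (\<Sum>k\<in>UNIV. real (n $ k) * (norm h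
          * (2 / v $ k)))"
        by (intro order_trans[OF sum_abs] sum_mono)
          (unfold abs_mult abs_of_nat, intro mult_left_mono, simp_all)
      then have "norm (a n * ((\<Prod>i\<in>UNIV. (u $ i) ^ (n $ i)) * (\<Sum>k\<in>UNIV. real (n $ k)
          * (h $ k / u $ k))))
         \<le> \<bar>a n\<bar> * ((\<Prod>i\<in>UNIV. (b * v $ i) ^ (n $ i)) * (\<Sum>k\<in>UNIV. real (n $ k) * (norm h
             * (2 / v $ k))))"
        unfolding real_norm_def abs_mult
        using le[OF u] nonneg[OF u] order_trans[OF nonneg[OF u] le[OF u]]
        by - (rule mult_left_mono[OF mult_mono], simp_all)
      also have "\<dots> = B n * norm h"
        by (simp add: B_def sum_distrib_left sum_distrib_right mult_ac)
      finally show ?thesis .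
    qed
    show "0 \<le> B n" for n
      unfolding B_def using v less_imp_le[OF v] b
      by (intro sum_nonneg mult_nonneg_nonneg prod_nonneg ballI zero_le_power) simp_all
    show "B summable_on UNIV"
      unfolding B_def
      by (rule summable_on_sum, rule summable_on_cmult_left,
          rule summable_on_powser_times_exponent[OF _ _ b(2) a]) (use less_imp_le[OF v] b in
              simp_all)
    show "(\<lambda>n. a n * (\<Prod>i\<in>UNIV. (u $ i) ^ (n $ i))) summable_on UNIV" if u: "u \<in> S" for u
    proof (rule abs_summable_summable, rule summable_on_comparison_test[OF a])
      fix n :: "nat ^ 'm"
      have "(\<Prod>i\<in>UNIV. (u $ i) ^ (n $ i)) \<le> (\<Prod>i\<in>UNIV. (c * v $ i) ^ (n $ i))"
      proof (intro prod_mono power_mono conjI zero_le_power)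
        fix i
        have "b * v $ i \<le> c * v $ i" using b v[of i] by (intro mult_right_mono) auto
        then show "u $ i \<le> c * v $ i" using mem[OF u, of i] by linarith
      qed (use mem[OF u] in \<open>auto simp: less_imp_le\<close>)
      then show "norm (a n * (\<Prod>i\<in>UNIV. (u $ i) ^ (n $ i))) \<le> \<bar>a n\<bar> * (\<Prod>i\<in>UNIV. (c
          * v $ i) ^ (n $ i))"
        using nonneg[OF u, of n] by (auto simp: abs_mult intro!: mult_left_mono)
    qed auto
  qed
  moreover have "at v within S = at v"
    by (rule at_within_open[OF vS]) (simp add: S_def open_box)
  ultimately show ?thesis by (simp only:)
qed

section \<open>Singular values and the weight domain\<close>

lemma scaled_nth: "scaled A w $ i $ j = complex_of_real (sqrt (w $ i)) * A $ i $ j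
    * complex_of_real (sqrt (w $ j))"
proof -
  have "(weight_mat w ** A) $ i $ l = complex_of_real (sqrt (w $ i)) * A $ i $ l" for l
    by (simp add: matrix_matrix_mult_def weight_mat_def if_distrib[where f = "\<lambda>x. x * _"]
        cong: if_cong)
  then show ?thesis
    by (simp add: scaled_def matrix_matrix_mult_def[of "weight_mat w ** A"])
      (simp add: weight_mat_def if_distrib[where f = "\<lambda>x. _ * x"] cong: if_cong)
qed

lemma scaled_scaleR:
  assumes "0 \<le> c"
  shows "scaled A (c *\<^sub>R w) = c *\<^sub>R scaled A w"
proof -
  have "complex_of_real (sqrt (c * x)) * a * complex_of_real (sqrt (c * y))
      = of_real c * (complex_of_real (sqrt x) * a * complex_of_real (sqrt y))" for x y a
  proof -
    have "complex_of_real (sqrt c) * complex_of_real (sqrt c) = of_real c"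
      using assms by (simp flip: of_real_mult)
    then show ?thesis by (simp add: real_sqrt_mult mult_ac)
  qed
  then show ?thesis by (simp add: vec_eq_iff scaled_nth) (simp add: scaleR_conv_of_real)
qed

text \<open>Adjoint times matrix scales by \<open>c^2\<close>, so dividing the eigenvalue equation
  by \<open>c^2\<close> turns the eigenvalue \<open>s^2\<close> into
  \<open>(s / c)^2\<close>.\<close>

lemma singular_values_scaleR:
  assumes c: "0 < c" and s: "s \<in> singular_values (c *\<^sub>R M)"
  shows "s / c \<in> singular_values M"
proof -
  obtain v where v: "0 \<le> s" "v \<noteq> 0"
    "(transpose (conj_mat (c *\<^sub>R M)) ** (c *\<^sub>R M)) *v v = complex_of_real (s\<^sup>2) *s v"
    using s unfolding singular_values_def by auto
  have "transpose (conj_mat (c *\<^sub>R M)) ** (c *\<^sub>R M) = c\<^sup>2 *\<^sub>R (transpose (conj_mat M) ** M)"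
    by (simp add: vec_eq_iff transpose_def conj_mat_def matrix_matrix_mult_def scaleR_sum_right
        power2_eq_square)
  then have "c\<^sup>2 *\<^sub>R ((transpose (conj_mat M) ** M) *v v) = complex_of_real (s\<^sup>2) *s v"
    using v(3) by (simp add: vec_eq_iff matrix_vector_mult_def scaleR_sum_right)
  then have "(1 / c\<^sup>2) *\<^sub>R (c\<^sup>2 *\<^sub>R ((transpose (conj_mat M) ** M) *v v))
      = (1 / c\<^sup>2) *\<^sub>R (complex_of_real (s\<^sup>2) *s v)"
    by simp
  also have "(1 / c\<^sup>2) *\<^sub>R (complex_of_real (s\<^sup>2) *s v) = complex_of_real ((s / c)\<^sup>2) *s v"
    by (simp add: vec_eq_iff) (simp add: scaleR_conv_of_real power_divide)
  finally have "(transpose (conj_mat M) ** M) *v v = complex_of_real ((s / c)\<^sup>2) *s v"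
    using c by simp
  then show ?thesis
    unfolding singular_values_def using v(1,2) c by auto
qed

lemma det_eq_0_iff_ker:
  fixes M :: "'a::field ^ 'n ^ 'n"
  shows "det M = 0 \<longleftrightarrow> (\<exists>v. v \<noteq> 0 \<and> M *v v = 0)"
  using matrix_left_invertible_ker[of M] invertible_det_nz[of M]
  by (metis invertible_left_inverse)

text \<open>The singular values are the nonnegative zeros of \<open>g\<close>, the characteristic
  determinant at \<open>t^2\<close>. As \<open>g\<close> is continuous and nonzero at 1, it has no
  zero near 1, which separates the singular values from 1.\<close>

lemma singular_values_lt_1_gap:
  fixes M :: "complex ^ 'n ^ 'n"
  assumes lt: "\<forall>s\<in>singular_values M. s < 1"
  obtains c where "1 < c" "\<forall>s\<in>singular_values M. c * s < 1"
proof -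
  define T where "T = transpose (conj_mat M) ** M"
  define g where "g t = det (mat (complex_of_real (t\<^sup>2)) - T)" for t :: real
  have mat: "mat a *v v = a *s v" for a :: complex and v :: "complex ^ 'n"
    by (simp add: vec_eq_iff matrix_vector_mult_def mat_def if_distrib[where f = "\<lambda>x. x * _"]
        cong: if_cong)
  have g0: "g t = 0 \<longleftrightarrow> (\<exists>v. v \<noteq> 0 \<and> T *v v = complex_of_real (t\<^sup>2) *s v)" for t
    unfolding g_def det_eq_0_iff_ker by (simp add: matrix_vector_mult_diff_rdistrib mat) metis
  have sing: "s \<in> singular_values M \<longleftrightarrow> 0 \<le> s \<and> g s = 0" for s
    unfolding g0 by (simp add: singular_values_def T_def)
  \<comment> \<open>After unfolding \<open>mat\<close>, the entries are conditionals on index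
    equality, which does not involve \<open>t\<close>; an arbitrary \<open>P\<close> covers both
    branches.\<close>
  have "isCont (\<lambda>t. if P then complex_of_real (t\<^sup>2) else 0) 1" for P
    by (cases P) (auto intro!: continuous_intros)
  then have "isCont g 1"
    unfolding g_def det_def mat_def by (simp, intro continuous_intros)
  moreover have "g 1 \<noteq> 0" using lt sing[of 1] by auto
  ultimately obtain d where d: "d > 0" "\<And>t. \<bar>t - 1\<bar> < d \<Longrightarrow> g t \<noteq> 0"
    using continuous_at_avoid[of 1 g 0] by (auto simp: dist_real_def abs_minus_commute)
  \<comment> \<open>The cap \<open>1/2\<close> keeps \<open>1 - r / 2\<close> positive. Singular
    values are at most \<open>1 - d\<close>, hence strictly below \<open>1 - r / 2\<close>, whose
    reciprocal is the witness.\<close>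
  define r where "r = min d (1/2)"
  have r: "0 < r" "r < 1" "r \<le> d" using d(1) by (auto simp: r_def)
  show thesis
  proof (rule that[of "1 / (1 - r / 2)"])
    show "\<forall>s\<in>singular_values M. 1 / (1 - r / 2) * s < 1"
    proof
      fix s assume s: "s \<in> singular_values M"
      have "s < 1" "\<not> \<bar>s - 1\<bar> < d" using s lt sing[of s] d(2) by auto
      then have "s < 1 - r / 2" using r by auto
      then show "1 / (1 - r / 2) * s < 1" using r by (simp add: field_simps)
    qed
  qed (use r in \<open>simp add: field_simps\<close>)
qed

text \<open>The weights enter \<open>scaled\<close> through two square roots, so scaling them by
  \<open>c\<close> scales the matrix and its singular values by \<open>c\<close>; the gap below 1
  leaves room for some \<open>c > 1\<close>.\<close>

lemma weight_domain_enlarge: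
  assumes "v \<in> weight_domain A"
  obtains c where "1 < c" "c *\<^sub>R v \<in> weight_domain A"
proof -
  have v: "\<And>k. 0 < v $ k" "\<forall>s\<in>singular_values (scaled A v). s < 1"
    using assms by (auto simp: weight_domain_def)
  obtain c where c: "1 < c" "\<forall>s\<in>singular_values (scaled A v). c * s < 1"
    using singular_values_lt_1_gap[OF v(2)] by blast
  have "c *\<^sub>R v \<in> weight_domain A"
    unfolding weight_domain_def
  proof (intro CollectI conjI ballI allI)
    fix s assume s: "s \<in> singular_values (scaled A (c *\<^sub>R v))"
    then show "0 \<le> s" by (simp add: singular_values_def)
    have "s / c \<in> singular_values (scaled A v)"
      using s c(1) by (simp add: scaled_scaleR singular_values_scaleR)
    with c(2) have "c * (s / c) < 1" by blast
    then show "s < 1" using c(1) by simp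
  qed (use v(1) c(1) in simp)
  with c(1) show thesis by (rule that)
qed

section \<open>Invertibility of the core matrix\<close>

lemma conj_mat_scaled: "transpose (conj_mat (scaled A w)) = conj_mat (scaled A w)" if "transpose A
    = A"
proof -
  have "A $ j $ i = A $ i $ j" for i j
    using that by (metis transpose_def vec_lambda_beta)
  then show ?thesis by (simp add: vec_eq_iff transpose_def conj_mat_def scaled_nth mult_ac)
qed

lemma sum_UNIV_Plus: "(\<Sum>k\<in>UNIV. f k) = (\<Sum>k\<in>UNIV. f (Inl k)) + (\<Sum>k\<in>UNIV. f (Inr k))"
  for f :: "'m::finite + 'm \<Rightarrow> 'a::comm_monoid_add"
  by (simp add: UNIV_Plus_UNIV[symmetric] sum.Plus del: UNIV_Plus_UNIV)

text \<open>A kernel vector with halves \<open>x\<close> and \<open>y\<close> satisfies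
  \<open>x = conj_mat B *v y\<close> and \<open>y = B *v x\<close>. By symmetry
  \<open>conj_mat B\<close> is the adjoint of \<open>B\<close>, so 1 would be a singular value of
  \<open>B\<close>.\<close>

lemma invertible_core:
  assumes sym: "transpose A = A" and w: "w \<in> weight_domain A"
  shows "invertible (core A w)"
proof (rule ccontr)
  define B where "B = scaled A w"
  assume "\<not> invertible (core A w)"
  then obtain z where z: "z \<noteq> 0" "core A w *v z = 0"
    using det_eq_0_iff_ker[of "core A w"] by (auto simp: invertible_det_nz)
  define x y where "x = (\<chi> k. z $ Inl k)" and "y = (\<chi> k. z $ Inr k)"
  have comp: "(core A w *v z) $ Inl k = (x - conj_mat B *v y) $ k"
       "(core A w *v z) $ Inr k = (y - B *v x) $ k" for k
    by (simp_all add: core_block B_def x_def y_def block_mat_def matrix_vector_mult_def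
        sum_UNIV_Plus
        mat_def sum_negf if_distrib[where f = "\<lambda>x. x * _"] cong: if_cong)
  have "x - conj_mat B *v y = 0" "y - B *v x = 0"
    using comp z(2) by (simp_all add: vec_eq_iff)
  then have y: "y = B *v x" and x: "x = conj_mat B *v (B *v x)" by auto
  have "x \<noteq> 0"
  proof
    assume "x = 0"
    then have "x = 0" "y = 0" using y by auto
    then have "z $ i = 0" for i by (cases i) (simp_all add: x_def y_def vec_eq_iff)
    with z(1) show False by (simp add: vec_eq_iff)
  qed
  moreover have "(transpose (conj_mat B) ** B) *v x = complex_of_real (1\<^sup>2) *s x"
    using x by (simp add: B_def conj_mat_scaled[OF sym] matrix_vector_mul_assoc)
  ultimately have "1 \<in> singular_values B" unfolding singular_values_def by auto
  with w show False by (auto simp: weight_domain_def B_def)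
qed

section \<open>Derivative of the normalisation constant\<close>

lemma matrix_inv_left_right:
  fixes M :: "'a::semiring_1 ^ 'n ^ 'm"
  assumes "invertible M"
  shows "matrix_inv M ** M = mat 1" "M ** matrix_inv M = mat 1"
  using assms someI_ex[of "\<lambda>N. M ** N = mat 1 \<and> N ** M = mat 1"]
  by (auto simp: invertible_def matrix_inv_def)

text \<open>Jacobi's formula. The product rule differentiates one row at a time. Writing
  \<open>M' h\<close> as \<open>M' h ** N ** M x\<close>, the new row \<open>i\<close> is a
  combination of the rows of \<open>M x\<close>, and Cramer's rule leaves only the coefficient at
  \<open>i\<close>.\<close>

lemma has_derivative_det:
  fixes M :: "'a::real_normed_vector \<Rightarrow> complex ^ 'n ^ 'n"
  assumes der: "\<And>i j. ((\<lambda>u. M u $ i $ j) has_derivative (\<lambda>h. M' h $ i $ j)) (at x within S)"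
    and inv: "invertible (M x)"
  shows "((\<lambda>u. det (M u)) has_derivative
    (\<lambda>h. det (M x) * trace (M' h ** matrix_inv (M x)))) (at x within S)"
proof -
  define N where "N = matrix_inv (M x)"
  have NM: "N ** M x = mat 1"
    using inv by (simp add: N_def matrix_inv_left_right)
  have row: "det (\<chi> r. if r = i then M' h $ i else M x $ r) = (M' h ** N) $ i $ i
      * det (M x)" for h i
  proof -
    have "(\<Sum>l\<in>UNIV. (M' h ** N) $ i $ l *s (M x $ l)) = (M' h ** N ** M x) $ i"
      by (simp add: vec_eq_iff matrix_matrix_mult_def[of "M' h ** N"])
    also have "\<dots> = M' h $ i"
      by (simp add: NM flip: matrix_mul_assoc)
    finally have *: "(\<Sum>l\<in>UNIV. (M' h ** N) $ i $ l *s (M x $ l)) = M' h $ i" .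
    have "row l (M x) = M x $ l" for l
      by (simp add: row_def vec_eq_iff)
    then show ?thesis
      using cramer_lemma_transpose[of i "(M' h ** N) $ i" "M x"] by (simp add: * cong: if_cong)
  qed
  have "((\<lambda>u. det (M u)) has_derivative
    (\<lambda>h. \<Sum>p | p permutes UNIV. of_int (sign p) *
       (\<Sum>i\<in>UNIV. M' h $ i $ p i * (\<Prod>j\<in>UNIV - {i}. M x $ j $ p j)))) (at x within S)"
    unfolding det_def
    by (intro has_derivative_sum has_derivative_mult_right has_derivative_prod der)
  also have "(\<lambda>h. \<Sum>p | p permutes UNIV. of_int (sign p) *
       (\<Sum>i\<in>UNIV. M' h $ i $ p i * (\<Prod>j\<in>UNIV - {i}. M x $ j $ p j)))
     = (\<lambda>h. \<Sum>i\<in>UNIV. det (\<chi> r. if r = i then M' h $ i else M x $ r))"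
  proof
    fix h
    \<comment> \<open>For fixed \<open>i\<close> the terms over all permutations expand the
      determinant with row \<open>i\<close> replaced, so exchanging two finite sums
      suffices.\<close>
    have *: "(\<Prod>r\<in>UNIV. (\<chi> r. if r = i then M' h $ i else M x $ r) $ r $ p r)
        = M' h $ i $ p i * (\<Prod>j\<in>UNIV - {i}. M x $ j $ p j)" for i p
      by (subst prod.remove[of UNIV i]) (auto intro!: prod.cong)
    show "(\<Sum>p | p permutes UNIV. of_int (sign p) *
       (\<Sum>i\<in>UNIV. M' h $ i $ p i * (\<Prod>j\<in>UNIV - {i}. M x $ j $ p j)))
     = (\<Sum>i\<in>UNIV. det (\<chi> r. if r = i then M' h $ i else M x $ r))"
      unfolding det_def * sum_distrib_left by (rule sum.swap)
  qed
  also have "\<dots> = (\<lambda>h. det (M x) * trace (M' h ** N))"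
    by (simp add: row trace_def sum_distrib_left mult.commute)
  finally show ?thesis by (simp add: N_def)
qed

text \<open>Differentiating \<open>sqrt (u $ i)\<close> reproduces it, multiplied by half the
  logarithmic derivative of \<open>u $ i\<close>. The two roots in an entry contribute one half
  each, and the entry itself survives as a factor.\<close>

lemma has_derivative_scaled_nth:
  assumes u: "\<And>k. 0 < u $ k"
  shows "((\<lambda>u. scaled A u $ k $ l) has_derivative
    (\<lambda>h. complex_of_real ((h $ k / u $ k + h $ l / u $ l) / 2) * scaled A u $ k $ l)) (at u)"
proof -
  have root: "((\<lambda>u::real^'a. sqrt (u $ i)) has_derivative (\<lambda>h. h $ i / u $ i / 2 * sqrt (u $ i)))
      (at u)" for i
  proof -
    have "((\<lambda>u::real^'a. sqrt (u $ i)) has_derivative (\<lambda>h. h $ i * (inverse (sqrt (u $ i)) / 2)))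
        (at u)"
      by (rule has_derivative_real_sqrt[OF u bounded_linear_imp_has_derivative[OF
          bounded_linear_vec_nth]])
    moreover have "inverse (sqrt (u $ i)) = sqrt (u $ i) / u $ i"
      using u[of i] by (simp add: field_simps flip: real_sqrt_mult)
    ultimately show ?thesis by (simp add: mult_ac)
  qed
  have "((\<lambda>u. complex_of_real (sqrt (u $ k) * sqrt (u $ l)) * A $ k $ l) has_derivative
    (\<lambda>h. complex_of_real (sqrt (u $ k) * (h $ l / u $ l / 2 * sqrt (u $ l))
       + (h $ k / u $ k / 2 * sqrt (u $ k)) * sqrt (u $ l)) * A $ k $ l)) (at u)"
    by (intro has_derivative_mult_left bounded_linear.has_derivative[OF bounded_linear_of_real]
        has_derivative_mult root)
  then show ?thesis
    by (simp add: scaled_nth[abs_def] algebra_simps add_divide_distrib)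
qed

text \<open>Both copies of a mode in the doubled index carry the same weight, so logarithmic
  derivatives depend on an index of \<open>core\<close> only through its mode.\<close>

definition mode_of :: "'a + 'a \<Rightarrow> 'a" where
  "mode_of = case_sum id id"

text \<open>The diagonal blocks of \<open>core\<close> are constant and the other two are built from
  \<open>scaled A u\<close> and its conjugate, so subtracting \<open>mat 1\<close> leaves exactly
  the varying part.\<close>

lemma has_derivative_core_nth:
  assumes u: "\<And>k. 0 < u $ k"
  shows "((\<lambda>u. core A u $ i $ j) has_derivative
    (\<lambda>h. complex_of_real ((h $ mode_of i / u $ mode_of i + h $ mode_of j / u $ mode_of j) / 2)
       * (core A u - mat 1) $ i $ j)) (at u)"
proof -
  note der = has_derivative_scaled_nth[OF u, of A]
  have der_cnj: "((\<lambda>u. cnj (scaled A u $ k $ l)) has_derivative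
    (\<lambda>h. complex_of_real ((h $ k / u $ k + h $ l / u $ l) / 2) * cnj (scaled A u $ k $ l)))
        (at u)" for k l
    using bounded_linear.has_derivative[OF bounded_linear_cnj der] by simp
  show ?thesis
    using has_derivative_minus[OF der] has_derivative_minus[OF der_cnj]
    by (cases i; cases j) (simp_all add: core_block block_mat_def conj_mat_def mat_def mode_of_def)
qed

section \<open>Logarithmic derivative of the determinant\<close>

lemma trace_diag_mult:
  "trace ((\<chi> i j. if i = j then d i else 0) ** M) = (\<Sum>i\<in>UNIV. d i
      * (M $ i $ i :: 'a::comm_semiring_1))"
  by (simp add: trace_def matrix_matrix_mult_def if_distrib[where f = "\<lambda>x. x * _"] cong: if_cong)

lemma matrix_add_rdistrib: "(A + B) ** C = A ** C + B ** C"
  by (simp add: vec_eq_iff matrix_matrix_mult_def distrib_right sum.distrib)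

lemma matrix_diff_ldistrib: "A ** (B - C) = A ** B - A ** C" for A :: "'a::ring_1 ^ 'n ^ 'm"
  by (simp add: vec_eq_iff matrix_matrix_mult_def right_diff_distrib sum_subtractf)

lemma matrix_diff_rdistrib: "(A - B) ** C = A ** C - B ** C" for A :: "'a::ring_1 ^ 'n ^ 'm"
  by (simp add: vec_eq_iff matrix_matrix_mult_def left_diff_distrib sum_subtractf)

text \<open>Jacobi's formula applies with
  \<open>M' h = E h ** (M - mat 1) + (M - mat 1) ** E h\<close>. Both summands, multiplied by the
  inverse \<open>N\<close>, have the same trace, which involves only the diagonal of
  \<open>N\<close>, and that diagonal encodes the mean photon numbers.\<close>

lemma has_derivative_det_core:
  assumes u: "\<And>k. 0 < u $ k" and inv: "invertible (core A u)"
  shows "((\<lambda>u. Re (det (core A u))) has_derivative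
    (\<lambda>h. - 2 * Re (det (core A u)) * (\<Sum>k\<in>UNIV. mean_photons A u k * (h $ k / u $ k)))) (at u)"
proof -
  define M where "M = core A u"
  define N where "N = matrix_inv M"
  define e where "e h i = complex_of_real (h $ mode_of i / u $ mode_of i)" for h i
  \<comment> \<open>Halves of the logarithmic derivatives: multiplication from the left and from the
    right adds the half of the row to the half of the column.\<close>
  define E :: "real^'a \<Rightarrow> complex ^ ('a + 'a) ^ ('a + 'a)" where "E h = (\<chi> i j. if i
      = j then e h i / 2 else 0)" for h
  define M' where "M' h = E h ** (M - mat 1) + (M - mat 1) ** E h" for h
  have MN: "N ** M = mat 1" "M ** N = mat 1"
    using inv by (simp_all add: M_def N_def matrix_inv_left_right)
  have "M' h $ i $ j = complex_of_real ((h $ mode_of i / u $ mode_of i + h $ mode_of j / u $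
      mode_of j) / 2)
       * (core A u - mat 1) $ i $ j" for h i j
    by (simp add: M'_def E_def matrix_matrix_mult_def M_def[symmetric] e_def algebra_simps
        add_divide_distrib
        if_distrib[where f = "\<lambda>x. x * _"] if_distrib[where f = "\<lambda>x. _ * x"] cong: if_cong)
  then have "((\<lambda>u. det (core A u)) has_derivative (\<lambda>h. det M * trace (M' h ** N))) (at u)"
    unfolding M_def N_def
    by (intro has_derivative_det inv) (simp only: has_derivative_core_nth[OF u])
  then have der: "((\<lambda>u. Re (det (core A u))) has_derivative (\<lambda>h. Re (det M * trace (M' h ** N))))
      (at u)"
    by (rule bounded_linear.has_derivative[OF bounded_linear_Re])
  have "Re (det M * trace (M' h ** N))
     = - 2 * Re (det M) * (\<Sum>k\<in>UNIV. mean_photons A u k * (h $ k / u $ k))" for h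
  proof -
    have "E h ** (M - mat 1) ** N = E h ** (mat 1 - N)"
      by (simp add: matrix_diff_rdistrib MN flip: matrix_mul_assoc)
    then have "M' h ** N = E h ** (mat 1 - N) + (M - mat 1) ** (E h ** N)"
      by (simp add: M'_def matrix_add_rdistrib matrix_mul_assoc)
    \<comment> \<open>Cyclicity moves \<open>M - mat 1\<close> to the right of \<open>N\<close>,
      where it again yields \<open>mat 1 - N\<close>.\<close>
    moreover have "trace ((M - mat 1) ** (E h ** N)) = trace (E h ** (mat 1 - N))"
    proof -
      have "trace ((M - mat 1) ** (E h ** N)) = trace (E h ** N ** (M - mat 1))"
        by (rule trace_mul_sym)
      also have "E h ** N ** (M - mat 1) = E h ** (mat 1 - N)"
        by (simp add: MN matrix_diff_ldistrib flip: matrix_mul_assoc)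
      finally show ?thesis .
    qed
    ultimately have "trace (M' h ** N) = 2 * trace (E h ** (mat 1 - N))"
      by (simp add: trace_add)
    also have "\<dots> = (\<Sum>i\<in>UNIV. e h i * (1 - N $ i $ i))"
      by (simp add: E_def trace_diag_mult sum_distrib_left mat_def)
    \<comment> \<open>The two copies of mode \<open>k\<close> share the factor
      \<open>h $ k / u $ k\<close>. With the shifts by 1/2 in \<open>covariance\<close>, the bracket
      is -2 times the mean photon number.\<close>
    also have "Re \<dots> = (\<Sum>k\<in>UNIV. h $ k / u $ k * (2 - Re (N $ Inl k $ Inl k + N $ Inr k $ Inr k)))"
      by (simp add: sum_UNIV_Plus e_def mode_of_def algebra_simps diff_divide_distrib
          add_divide_distrib flip: sum.distrib)
    also have "\<dots> = - 2 * (\<Sum>k\<in>UNIV. mean_photons A u k * (h $ k / u $ k))"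
      unfolding sum_distrib_left
      by (intro sum.cong) (simp_all add: mean_photons_def covariance_def mat_def N_def M_def
          algebra_simps)
    \<comment> \<open>The determinant is real, so it can be pulled out of the real part.\<close>
    finally show ?thesis
      using det_core_real[of A u] by (simp add: M_def)
  qed
  with der show ?thesis by (simp add: M_def)
qed

text \<open>The determinant is real and nonzero, so its real part cannot vanish. This allows
  \<open>inv_Z\<close> to be divided out of a convergent expectation.\<close>

lemma inv_Z_nonzero:
  assumes "transpose A = A" "v \<in> weight_domain A"
  shows "Re (det (core A v)) \<noteq> 0" "inv_Z A v \<noteq> 0"
proof -
  have "det (core A v) \<noteq> 0"
    using invertible_core[OF assms] by (simp add: invertible_det_nz)
  then show "Re (det (core A v)) \<noteq> 0"
    using det_core_real[of A v] by (auto simp: complex_eq_iff)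
  then show "inv_Z A v \<noteq> 0" by (simp add: inv_Z_def)
qed

text \<open>\<open>sqrt\<close> is odd on the reals, so nonvanishing of the determinant suffices; its sign plays
  no role.\<close>

lemma has_derivative_inv_Z:
  assumes "transpose A = A" "v \<in> weight_domain A"
  shows "(inv_Z A has_derivative
    (\<lambda>h. - inv_Z A v * (\<Sum>k\<in>UNIV. mean_photons A v k * (h $ k / v $ k)))) (at v)"
proof -
  let ?D = "Re (det (core A v))"
  have D: "?D \<noteq> 0" using inv_Z_nonzero[OF assms] by simp
  \<comment> \<open>This form of the slope fits both signs and cancels the factor
    \<open>2 * ?D\<close> in the derivative of the determinant.\<close>
  have "(sqrt has_real_derivative (sqrt ?D / (2 * ?D))) (at ?D)"
  proof (rule DERIV_real_sqrt_generic[OF D])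
    have "inverse (sqrt ?D) = sqrt ?D / \<bar>?D\<bar>"
      using D by (simp add: field_simps flip: real_sqrt_mult)
    then show "?D > 0 \<Longrightarrow> sqrt ?D / (2 * ?D) = inverse (sqrt ?D) / 2"
      and "?D < 0 \<Longrightarrow> sqrt ?D / (2 * ?D) = - inverse (sqrt ?D) / 2" by simp_all
  qed
  moreover have "v $ k > 0" for k using assms(2) by (simp add: weight_domain_def)
  ultimately have "((\<lambda>u. sqrt (Re (det (core A u)))) has_derivative
    (\<lambda>h. (- 2 * ?D * (\<Sum>k\<in>UNIV. mean_photons A v k * (h $ k / v $ k))) * (sqrt ?D / (2 * ?D))))
        (at v)"
    by (intro DERIV_compose_FDERIV has_derivative_det_core invertible_core assms)
  then show ?thesis using D by (simp add: inv_Z_def[abs_def] field_simps)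
qed

section \<open>The gradient formula\<close>

text \<open>The variable here is the weight vector itself; parameters enter later by the chain rule.
  In the product rule the series contributes \<open>n $ k\<close> and the normalisation
  \<open>- mean_photons A v k\<close>.\<close>

lemma gbs_expectation_has_derivative:
  fixes A :: "complex ^ 'm ^ 'm" and H :: "nat ^ 'm \<Rightarrow> real"
  assumes sym: "transpose A = A" and v: "v \<in> weight_domain A"
    and summable: "\<And>v. v \<in> weight_domain A \<Longrightarrow> (\<lambda>n. \<bar>H n * gbs_prob A v n\<bar>) summable_on UNIV"
  defines "f \<equiv> \<lambda>k n. H n * gbs_prob A v n * (real (n $ k) - mean_photons A v k)"
  shows "f k summable_on UNIV"
    and "((\<lambda>u. \<Sum>\<^sub>\<infinity>n. H n * gbs_prob A u n) has_derivative
      (\<lambda>h. \<Sum>k\<in>UNIV. (\<Sum>\<^sub>\<infinity>n. f k n) * (h $ k / v $ k))) (at v)"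
proof -
  define a where "a n = H n * (cmod (hafnian (rep_index n) (rep_matrix A)))\<^sup>2
      / (\<Prod>i\<in>UNIV. fact (n $ i))"
    for n :: "nat ^ 'm"
  define p where "p u n = a n * (\<Prod>i\<in>UNIV. (u $ i) ^ (n $ i))" for u and n :: "nat ^ 'm"
  have gbs: "H n * gbs_prob A u n = inv_Z A u * p u n" for n u
    by (simp add: gbs_prob_def p_def a_def prod_dividef)
  have pos: "v $ k > 0" for k using v by (simp add: weight_domain_def)
  obtain c where c: "1 < c" "c *\<^sub>R v \<in> weight_domain A"
    using weight_domain_enlarge[OF v] .
  \<comment> \<open>Convergence is assumed on all of \<open>weight_domain A\<close>, so it is
    available at the enlarged point, where the nonzero \<open>inv_Z\<close> is divided out.\<close>
  have "(\<lambda>n. \<bar>inv_Z A (c *\<^sub>R v)\<bar> * \<bar>p (c *\<^sub>R v) n\<bar>) summable_on UNIV"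
    using summable[OF c(2)] by (simp add: gbs abs_mult)
  then have "(\<lambda>n. \<bar>p (c *\<^sub>R v) n\<bar>) summable_on UNIV"
    using inv_Z_nonzero[OF sym c(2)] by (simp add: summable_on_cmult_right')
  moreover have "\<bar>p (c *\<^sub>R v) n\<bar> = \<bar>a n\<bar> * (\<Prod>i\<in>UNIV. (c * v $ i) ^ (n $ i))" for n
    using c(1) less_imp_le[OF pos] by (simp add: p_def abs_mult abs_prod power_abs)
  ultimately have a: "(\<lambda>n. \<bar>a n\<bar> * (\<Prod>i\<in>UNIV. (c * v $ i) ^ (n $ i))) summable_on UNIV"
    by simp
  have pn: "(\<lambda>n. p v n * real (n $ k)) summable_on UNIV" for k
  proof -
    \<comment> \<open>The radii are \<open>1\<close> and \<open>c\<close>; the literal factor 1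
      matches the case \<open>b = 1\<close>.\<close>
    have "(\<lambda>n. \<bar>a n\<bar> * (\<Prod>i\<in>UNIV. (1 * v $ i) ^ (n $ i)) * real (n $ k)) summable_on UNIV"
      using c(1) less_imp_le[OF pos] a by (intro summable_on_powser_times_exponent[of v 1 c a k])
          simp_all
    moreover have "\<bar>p v n * real (n $ k)\<bar> = \<bar>a n\<bar> * (\<Prod>i\<in>UNIV. (1 * v $ i) ^ (n $ i))
        * real (n $ k)" for n
      using less_imp_le[OF pos] by (simp add: p_def abs_mult abs_prod power_abs)
    ultimately show ?thesis
      by - (rule abs_summable_summable, simp)
  qed
  have "(\<lambda>n. \<bar>inv_Z A v\<bar> * \<bar>p v n\<bar>) summable_on UNIV"
    using summable[OF v] by (simp add: gbs abs_mult)
  then have p: "p v summable_on UNIV"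
    using inv_Z_nonzero[OF sym v]
    by - (rule abs_summable_summable, simp add: summable_on_cmult_right')
  have f: "(f k has_sum inv_Z A v * (\<Sum>\<^sub>\<infinity>n. p v n * real (n $ k))
      + (- (inv_Z A v * mean_photons A v k)) * (\<Sum>\<^sub>\<infinity>n. p v n)) UNIV" for k
  proof -
    have "((\<lambda>n. inv_Z A v * (p v n * real (n $ k)) + (- (inv_Z A v * mean_photons A v k))
        * p v n) has_sum
      inv_Z A v * (\<Sum>\<^sub>\<infinity>n. p v n * real (n $ k)) + (- (inv_Z A v * mean_photons A v k))
          * (\<Sum>\<^sub>\<infinity>n. p v n)) UNIV"
      by (intro has_sum_add has_sum_cmult_right has_sum_infsum p pn)
    also have "(\<lambda>n. inv_Z A v * (p v n * real (n $ k)) + (- (inv_Z A v * mean_photons A v k))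
        * p v n) = f k"
      by (simp add: fun_eq_iff f_def gbs algebra_simps)
    finally show ?thesis .
  qed
  show "f k summable_on UNIV" using f by (rule has_sum_imp_summable)
  \<comment> \<open>The sum over modes is finite and each mode converges by \<open>pn\<close>, so it
    may be exchanged with the series.\<close>
  have G': "(\<Sum>\<^sub>\<infinity>n. a n * ((\<Prod>i\<in>UNIV. (v $ i) ^ (n $ i)) * (\<Sum>k\<in>UNIV. real (n $ k) * (h $ k / v $ k))))
      = (\<Sum>k\<in>UNIV. (\<Sum>\<^sub>\<infinity>n. p v n * real (n $ k)) * (h $ k / v $ k))" for h
  proof -
    have "((\<lambda>n. \<Sum>k\<in>UNIV. p v n * real (n $ k) * (h $ k / v $ k)) has_sum
       (\<Sum>k\<in>UNIV. (\<Sum>\<^sub>\<infinity>n. p v n * real (n $ k)) * (h $ k / v $ k))) UNIV"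
      by (intro has_sum_sum has_sum_cmult_left has_sum_infsum pn)
    then show ?thesis
      by (intro infsumI) (simp add: p_def sum_distrib_left mult.assoc)
  qed
  have "((\<lambda>u. inv_Z A u * (\<Sum>\<^sub>\<infinity>n. p u n)) has_derivative
    (\<lambda>h. inv_Z A v * (\<Sum>k\<in>UNIV. (\<Sum>\<^sub>\<infinity>n. p v n * real (n $ k)) * (h $ k / v $ k))
       + (- inv_Z A v * (\<Sum>k\<in>UNIV. mean_photons A v k * (h $ k / v $ k))) * (\<Sum>\<^sub>\<infinity>n. p v n))) (at v)"
    using has_derivative_powser[OF pos c(1) a]
    unfolding G' p_def[symmetric, abs_def]
    by (intro has_derivative_mult has_derivative_inv_Z sym v) (simp add: p_def)
  moreover have "(\<Sum>\<^sub>\<infinity>n. H n * gbs_prob A u n) = inv_Z A u * (\<Sum>\<^sub>\<infinity>n. p u n)" for u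
    unfolding gbs by (rule infsum_cmult_right')
  moreover have "inv_Z A v * (\<Sum>k\<in>UNIV. (\<Sum>\<^sub>\<infinity>n. p v n * real (n $ k)) * (h $ k / v $ k))
       + (- inv_Z A v * (\<Sum>k\<in>UNIV. mean_photons A v k * (h $ k / v $ k))) * (\<Sum>\<^sub>\<infinity>n. p v n)
     = (\<Sum>k\<in>UNIV. (\<Sum>\<^sub>\<infinity>n. f k n) * (h $ k / v $ k))" for h
    by (simp add: infsumI[OF f] ring_distribs sum.distrib sum_distrib_left sum_distrib_right
        sum_negf sum_subtractf mult_ac)
  ultimately show "((\<lambda>u. \<Sum>\<^sub>\<infinity>n. H n * gbs_prob A u n) has_derivative
      (\<lambda>h. \<Sum>k\<in>UNIV. (\<Sum>\<^sub>\<infinity>n. f k n) * (h $ k / v $ k))) (at v)"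
    by simp
qed

text \<open>The chain rule along \<open>x + t *\<^sub>R e\<close> gives
  \<open>f' (t *\<^sub>R e)\<close>, and linearity makes this multiplication by the number
  \<open>f' e\<close>.\<close>

lemma gradient_eq_has_derivative:
  assumes "(f has_derivative f') (at x)"
  shows "gradient f x = (\<chi> j. f' (axis j 1))"
proof -
  have "((\<lambda>t. f (x + t *\<^sub>R e)) has_field_derivative f' e) (at 0)" for e
  proof -
    have "((\<lambda>t. x + t *\<^sub>R e) has_derivative (\<lambda>t. t *\<^sub>R e)) (at 0)"
      by (auto intro!: derivative_eq_intros)
    then have "((\<lambda>t. f (x + t *\<^sub>R e)) has_derivative (\<lambda>t. f' (t *\<^sub>R e))) (at 0)"
      by (rule has_derivative_compose) (simp add: assms)
    moreover have "(\<lambda>t. f' (t *\<^sub>R e)) = (*) (f' e)"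
      using linear_scale[OF has_derivative_linear[OF assms]] by (auto simp: mult.commute)
    ultimately show ?thesis by (simp add: has_field_derivative_def)
  qed
  then have "deriv (\<lambda>t. f (x + t *\<^sub>R e)) 0 = f' e" for e
    by (rule DERIV_imp_deriv)
  then show ?thesis by (simp add: gradient_def)
qed

text \<open>\<open>deriv\<close> and \<open>infsum\<close> are total, so the equation alone would
  not assert that the derivative exists or that the expectation converges. Differentiability and
  absolute convergence are therefore part of the conclusion.\<close>

theorem mainTheorem3:
  fixes A :: "complex ^ 'm ^ 'm"
    and H :: "nat ^ 'm \<Rightarrow> real"
    and w :: "real ^ 'd \<Rightarrow> real ^ 'm"
    and \<Omega> :: "(real ^ 'd) set"
    and C :: "real ^ 'd \<Rightarrow> real"
  assumes "transpose A = A"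
    and "\<And>v. v \<in> weight_domain A \<Longrightarrow> (\<lambda>n. \<bar>H n * gbs_prob A v n\<bar>) summable_on UNIV"
    and "open \<Omega>"
    and "\<And>\<theta>. \<theta> \<in> \<Omega> \<Longrightarrow> w differentiable (at \<theta>)"
    and "\<And>\<theta>. \<theta> \<in> \<Omega> \<Longrightarrow> w \<theta> \<in> weight_domain A"
    and "\<And>\<theta>. \<theta> \<in> \<Omega> \<Longrightarrow> C \<theta> = (\<Sum>\<^sub>\<infinity>n. H n * gbs_prob A (w \<theta>) n)"
    and "\<theta> \<in> \<Omega>"
  shows "C differentiable (at \<theta>)
    \<and> (\<lambda>n. norm (gbs_prob A (w \<theta>) n *\<^sub>R
          (\<Sum>k\<in>UNIV. (H n * (real (n $ k) - mean_photons A (w \<theta>) k)) *\<^sub>R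
             gradient (\<lambda>\<eta>. ln (w \<eta> $ k)) \<theta>))) summable_on UNIV
    \<and> gradient C \<theta> = expect (gbs_prob A (w \<theta>))
          (\<lambda>n. \<Sum>k\<in>UNIV. (H n * (real (n $ k) - mean_photons A (w \<theta>) k)) *\<^sub>R
             gradient (\<lambda>\<eta>. ln (w \<eta> $ k)) \<theta>)"
proof -
  define v where "v = w \<theta>"
  define f where "f k n = H n * gbs_prob A v n * (real (n $ k) - mean_photons A v k)" for k n
  define g where "g k = gradient (\<lambda>\<eta>. ln (w \<eta> $ k)) \<theta>" for k
  have v: "v \<in> weight_domain A" using assms(5,7) by (simp add: v_def)
  then have pos: "v $ k > 0" for k by (simp add: weight_domain_def)
  obtain w' where w': "(w has_derivative w') (at \<theta>)"
    using assms(4,7) unfolding differentiable_def by blast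
  have f: "f k summable_on UNIV" for k
    unfolding f_def by (rule gbs_expectation_has_derivative(1)[OF assms(1) v assms(2)])
  have "((\<lambda>\<eta>. \<Sum>\<^sub>\<infinity>n. H n * gbs_prob A (w \<eta>) n) has_derivative
      (\<lambda>h. \<Sum>k\<in>UNIV. (\<Sum>\<^sub>\<infinity>n. f k n) * (w' h $ k / v $ k))) (at \<theta>)"
    unfolding f_def
    by (rule has_derivative_compose[OF w']) (use gbs_expectation_has_derivative(2)[OF assms(1) v
        assms(2)] v_def in simp)
  \<comment> \<open>\<open>C\<close> is known to agree with the series only on \<Omega>; openness
    transfers the derivative.\<close>
  then have C: "(C has_derivative (\<lambda>h. \<Sum>k\<in>UNIV. (\<Sum>\<^sub>\<infinity>n. f k n) * (w' h $ k / v $ k))) (at \<theta>)"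
    by (rule has_derivative_transform_within_open[OF _ assms(3,7)]) (simp add: assms(6))
  have g: "g k = (\<chi> j. w' (axis j 1) $ k / v $ k)" for k
  proof -
    have "((\<lambda>\<eta>. w \<eta> $ k) has_derivative (\<lambda>h. w' h $ k)) (at \<theta>)"
      by (rule bounded_linear.has_derivative[OF bounded_linear_vec_nth w'])
    then have "((\<lambda>\<eta>. ln (w \<eta> $ k)) has_derivative (\<lambda>h. w' h $ k * (1 / v $ k))) (at \<theta>)"
      using pos[of k] unfolding v_def by (intro DERIV_compose_FDERIV[OF DERIV_ln_divide])
    then show ?thesis
      unfolding g_def by (subst gradient_eq_has_derivative) auto
  qed
  have terms: "gbs_prob A v n *\<^sub>R (\<Sum>k\<in>UNIV. (H n * (real (n $ k) - mean_photons A v k)) *\<^sub>R g k)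
      = (\<Sum>k\<in>UNIV. f k n *\<^sub>R g k)" for n
    by (simp add: scaleR_sum_right f_def mult_ac)
  \<comment> \<open>Triangle inequality over finitely many modes; each real family
    \<open>f k\<close> is absolutely summable.\<close>
  have "(\<lambda>n. norm (\<Sum>k\<in>UNIV. f k n *\<^sub>R g k)) summable_on UNIV"
  proof (rule summable_on_comparison_test)
    show "(\<lambda>n. \<Sum>k\<in>UNIV. \<bar>f k n\<bar> * norm (g k)) summable_on UNIV"
      using f[THEN summable_on_iff_abs_summable_on_real[THEN iffD1]]
      by (intro summable_on_sum summable_on_cmult_left) simp
    show "norm (\<Sum>k\<in>UNIV. f k n *\<^sub>R g k) \<le> (\<Sum>k\<in>UNIV. \<bar>f k n\<bar> * norm (g k))" for n
      using norm_sum[of "\<lambda>k. f k n *\<^sub>R g k" UNIV] by simp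
  qed auto
  \<comment> \<open>Scaling the fixed vector \<open>g k\<close> is bounded linear in the scalar and
    so commutes with the infinite sum.\<close>
  moreover have "(\<Sum>\<^sub>\<infinity>n. \<Sum>k\<in>UNIV. f k n *\<^sub>R g k) = (\<Sum>k\<in>UNIV. (\<Sum>\<^sub>\<infinity>n. f k n) *\<^sub>R g k)"
    by (intro infsumI has_sum_sum has_sum_bounded_linear[OF bounded_linear_scaleR_left]
        has_sum_infsum f)
  moreover have "gradient C \<theta> = (\<Sum>k\<in>UNIV. (\<Sum>\<^sub>\<infinity>n. f k n) *\<^sub>R g k)"
    by (simp add: gradient_eq_has_derivative[OF C] g vec_eq_iff)
  ultimately show ?thesis
    using C unfolding v_def[symmetric] g_def[symmetric] expect_def terms
    by (auto simp: differentiable_def)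
qed

end
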